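(* Let $\mathcal{P} = \langle X : R\rangle$ be an inverse monoid presentation, where $R$ is a set of pairs $(\ell,r)$ with $\ell,r\in \mathrm{FIM}(X)$. Let $K(\mathcal{P})$ be the kernel of the congruence $\simeq_{\mathcal{P}}$ on $\mathrm{FIM}(X)$ generated by $R$, and let $N(\mathcal{P})$ be the smallest normal inverse subsemigroup of $\mathrm{FIM}(X)$ containing the set $$Q(R)=\{\ell^{-1}r,\ \ell r^{-1} : (\ell,r)\in R\}.$$ Then $$N(\mathcal{P})\subseteq K(\mathcal{P})\subseteq N(\mathcal{P})^{\uparrow}.$$
   Context: $\mathrm{FIM}(X)$ is the free inverse monoid on the set $X$. For an inverse semigroup $S$ with semilattice of idempotents $E(S)$, the kernel of a congruence $\rho$ on $S$ is $\{s\in S : s\mathrel{\rho}e\text{ for some }e\in E(S)\}$. An inverse subsemigroup $N$ of $S$ is normal if $E(N)=E(S)$ and $s^{-1}ns\in N$ for all $s\in S$, $n\in N$. For $A\subseteq S$, $A^{\uparrow}=\{s\in S: a\leq s\text{ for some }a\in A\}$ is the smallest subset of $S$ containing $A$ that is closed upwards in the natural partial order. *)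

theory Defs
  imports "HOL-Algebra.Group"
begin

section \<open>Inverse semigroups and monoids\<close>

definition inverse_of :: "('a, 'b) monoid_scheme \<Rightarrow> 'a \<Rightarrow> 'a \<Rightarrow> bool" where
  "inverse_of S s t \<longleftrightarrow>
     t \<in> carrier S \<and> s \<otimes>\<^bsub>S\<^esub> t \<otimes>\<^bsub>S\<^esub> s = s \<and> t \<otimes>\<^bsub>S\<^esub> s \<otimes>\<^bsub>S\<^esub> t = t"

definition inverse_monoid :: "('a, 'b) monoid_scheme \<Rightarrow> bool" where
  "inverse_monoid S \<longleftrightarrow> monoid S \<and> (\<forall>s \<in> carrier S. \<exists>!t. inverse_of S s t)"

text \<open>This is not the group-theoretic \<open>m_inv\<close> of the library, which is meaningful only on units.\<close>

definition sinv :: "('a, 'b) monoid_scheme \<Rightarrow> 'a \<Rightarrow> 'a" where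
  "sinv S s = (THE t. inverse_of S s t)"

definition idempotents :: "('a, 'b) monoid_scheme \<Rightarrow> 'a set" where
  "idempotents S = {e \<in> carrier S. e \<otimes>\<^bsub>S\<^esub> e = e}"

definition nat_le :: "('a, 'b) monoid_scheme \<Rightarrow> 'a \<Rightarrow> 'a \<Rightarrow> bool" where
  "nat_le S s t \<longleftrightarrow>
     s \<in> carrier S \<and> t \<in> carrier S \<and> (\<exists>e \<in> idempotents S. s = e \<otimes>\<^bsub>S\<^esub> t)"

definition up_closure :: "('a, 'b) monoid_scheme \<Rightarrow> 'a set \<Rightarrow> 'a set" where
  "up_closure S A = {s \<in> carrier S. \<exists>a \<in> A. nat_le S a s}"

definition inverse_subsemigroup :: "('a, 'b) monoid_scheme \<Rightarrow> 'a set \<Rightarrow> bool" where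
  "inverse_subsemigroup S N \<longleftrightarrow>
     N \<subseteq> carrier S \<and>
     (\<forall>m \<in> N. \<forall>n \<in> N. m \<otimes>\<^bsub>S\<^esub> n \<in> N) \<and>
     (\<forall>n \<in> N. sinv S n \<in> N)"

text \<open>\<open>N \<inter> idempotents S\<close> is the set \<open>E(N)\<close>, as \<open>N\<close> carries the multiplication of \<open>S\<close>.\<close>

definition normal_inverse_subsemigroup :: "('a, 'b) monoid_scheme \<Rightarrow> 'a set \<Rightarrow> bool" where
  "normal_inverse_subsemigroup S N \<longleftrightarrow>
     inverse_subsemigroup S N \<and>
     N \<inter> idempotents S = idempotents S \<and>
     (\<forall>s \<in> carrier S. \<forall>n \<in> N. sinv S s \<otimes>\<^bsub>S\<^esub> n \<otimes>\<^bsub>S\<^esub> s \<in> N)"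

text \<open>For \<open>A \<subseteq> carrier S\<close> the intersection is over a nonempty family (\<open>carrier S\<close> belongs to it
  when \<open>S\<close> is an inverse monoid), and it is itself a member of the family.\<close>

definition normal_closure :: "('a, 'b) monoid_scheme \<Rightarrow> 'a set \<Rightarrow> 'a set" where
  "normal_closure S A = \<Inter>{N. normal_inverse_subsemigroup S N \<and> A \<subseteq> N}"


section \<open>Congruences\<close>

definition congruence_on :: "('a, 'b) monoid_scheme \<Rightarrow> ('a \<times> 'a) set \<Rightarrow> bool" where
  "congruence_on S \<rho> \<longleftrightarrow>
     equiv (carrier S) \<rho> \<and>
     (\<forall>a b c. (a, b) \<in> \<rho> \<longrightarrow> c \<in> carrier S \<longrightarrow>
       (c \<otimes>\<^bsub>S\<^esub> a, c \<otimes>\<^bsub>S\<^esub> b) \<in> \<rho> \<and> (a \<otimes>\<^bsub>S\<^esub> c, b \<otimes>\<^bsub>S\<^esub> c) \<in> \<rho>)"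

definition congruence_generated ::
    "('a, 'b) monoid_scheme \<Rightarrow> ('a \<times> 'a) set \<Rightarrow> ('a \<times> 'a) set" where
  "congruence_generated S R = \<Inter>{\<rho>. congruence_on S \<rho> \<and> R \<subseteq> \<rho>}"

definition congruence_kernel :: "('a, 'b) monoid_scheme \<Rightarrow> ('a \<times> 'a) set \<Rightarrow> 'a set" where
  "congruence_kernel S \<rho> = {s \<in> carrier S. \<exists>e \<in> idempotents S. (s, e) \<in> \<rho>}"

definition quotient_monoid :: "('a, 'b) monoid_scheme \<Rightarrow> ('a \<times> 'a) set \<Rightarrow> 'a set monoid" where
  "quotient_monoid S \<rho> =
     \<lparr>carrier = carrier S // \<rho>,
      mult = (\<lambda>A B. \<Union>a \<in> A. \<Union>b \<in> B. \<rho> `` {a \<otimes>\<^bsub>S\<^esub> b}),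
      one = \<rho> `` {\<one>\<^bsub>S\<^esub>}\<rparr>"


section \<open>The free inverse monoid\<close>

text \<open>Words over \<open>X \<union> X\<inverse>\<close>: the letter \<open>(x, True)\<close> stands for \<open>x\<close>, and \<open>(x, False)\<close> for its formal
  inverse.\<close>

type_synonym 'a word = "('a \<times> bool) list"

definition words :: "'a set \<Rightarrow> 'a word monoid" where
  "words X = \<lparr>carrier = lists (X \<times> UNIV), mult = (@), one = []\<rparr>"

definition word_inv :: "'a word \<Rightarrow> 'a word" where
  "word_inv w = rev (map (\<lambda>(x, b). (x, \<not> b)) w)"

definition wagner_pairs :: "'a set \<Rightarrow> ('a word \<times> 'a word) set" where
  "wagner_pairs X =
     {(w @ word_inv w @ w, w) | w. w \<in> carrier (words X)} \<union>
     {(u @ word_inv u @ v @ word_inv v, v @ word_inv v @ u @ word_inv u) | u v.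
        u \<in> carrier (words X) \<and> v \<in> carrier (words X)}"

text \<open>The standard construction of the free inverse monoid: the words modulo the Wagner congruence.\<close>

definition FIM :: "'a set \<Rightarrow> 'a word set monoid" where
  "FIM X = quotient_monoid (words X) (congruence_generated (words X) (wagner_pairs X))"


subsection \<open>It is an inverse monoid, with inversion induced by \<open>word_inv\<close>\<close>

abbreviation wagner :: "'a set \<Rightarrow> ('a word \<times> 'a word) set" where
  "wagner X \<equiv> congruence_generated (words X) (wagner_pairs X)"

lemma word_inv_simps [simp]:
  "word_inv [] = []"
  "word_inv (u @ v) = word_inv v @ word_inv u"
  "word_inv (word_inv w) = w"
  by (auto simp: word_inv_def rev_map[symmetric] comp_def case_prod_beta map_idI)

lemma words_simps [simp]: "mult (words X) = (@)" "one (words X) = []"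
  by (auto simp: words_def)

lemma words_closed [simp]:
  "[] \<in> carrier (words X)"
  "u @ v \<in> carrier (words X) \<longleftrightarrow> u \<in> carrier (words X) \<and> v \<in> carrier (words X)"
  "word_inv u \<in> carrier (words X) \<longleftrightarrow> u \<in> carrier (words X)"
  by (fastforce simp: words_def word_inv_def in_lists_conv_set)+

lemma congruence_on_generated:
  assumes "monoid S" "R \<subseteq> carrier S \<times> carrier S"
  shows "congruence_on S (congruence_generated S R)"
proof -
  interpret monoid S by fact
  have full: "congruence_on S (carrier S \<times> carrier S)"
    by (auto simp: congruence_on_def equiv_def refl_on_def sym_def trans_def)
  then have "congruence_generated S R \<subseteq> carrier S \<times> carrier S"
    using assms(2) by (auto simp: congruence_generated_def)
  moreover have "refl_on (carrier S) (congruence_generated S R)"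
    by (auto simp: congruence_generated_def refl_on_def congruence_on_def equiv_def)
  moreover have "sym (congruence_generated S R)"
    unfolding congruence_generated_def
    by (rule symI) (auto simp: congruence_on_def equiv_def dest: symD)
  moreover have "trans (congruence_generated S R)"
    unfolding congruence_generated_def
    by (rule transI) (simp add: congruence_on_def equiv_def, meson transD)
  moreover have "(c \<otimes>\<^bsub>S\<^esub> a, c \<otimes>\<^bsub>S\<^esub> b) \<in> congruence_generated S R"
      "(a \<otimes>\<^bsub>S\<^esub> c, b \<otimes>\<^bsub>S\<^esub> c) \<in> congruence_generated S R"
    if "(a, b) \<in> congruence_generated S R" "c \<in> carrier S" for a b c
    using that unfolding congruence_generated_def congruence_on_def by blast+
  ultimately show ?thesis
    by (simp add: congruence_on_def equiv_def)
qed

lemma congruence_on_wagner: "congruence_on (words X) (wagner X)"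
proof (rule congruence_on_generated)
  show "monoid (words X)" by unfold_locales auto
  show "wagner_pairs X \<subseteq> carrier (words X) \<times> carrier (words X)"
    by (auto simp: wagner_pairs_def)
qed

lemma equiv_wagner: "equiv (carrier (words X)) (wagner X)"
  using congruence_on_wagner[of X] by (simp add: congruence_on_def)

lemma wagner_mult:
  assumes "(a, a') \<in> wagner X" "(b, b') \<in> wagner X"
  shows "(a @ b, a' @ b') \<in> wagner X"
proof -
  have *: "a' \<in> carrier (words X)" "b \<in> carrier (words X)"
    using equiv_type[OF equiv_wagner[of X]] assms by auto
  then have "(a @ b, a' @ b) \<in> wagner X" "(a' @ b, a' @ b') \<in> wagner X"
    using congruence_on_wagner[of X] assms unfolding congruence_on_def by fastforce+
  then show ?thesis using equiv_wagner[of X] unfolding equiv_def by (meson transD)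
qed

lemma wagner_base: "wagner_pairs X \<subseteq> wagner X"
  by (auto simp: congruence_generated_def)

definition fim_class :: "'a set \<Rightarrow> 'a word \<Rightarrow> 'a word set" where
  "fim_class X w = wagner X `` {w}"

lemma fim_carrier: "carrier (FIM X) = fim_class X ` carrier (words X)"
  by (auto simp: FIM_def quotient_monoid_def quotient_def fim_class_def)

lemma fim_one: "\<one>\<^bsub>FIM X\<^esub> = fim_class X []"
  by (simp add: FIM_def quotient_monoid_def fim_class_def)

lemma fim_class_eqI: "(a, b) \<in> wagner X \<Longrightarrow> fim_class X a = fim_class X b"
  unfolding fim_class_def by (rule equiv_class_eq[OF equiv_wagner])

lemma fim_mult:
  assumes "a \<in> carrier (words X)" "b \<in> carrier (words X)"
  shows "fim_class X a \<otimes>\<^bsub>FIM X\<^esub> fim_class X b = fim_class X (a @ b)"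
proof -
  have "fim_class X (a' @ b') = fim_class X (a @ b)"
    if "a' \<in> fim_class X a" "b' \<in> fim_class X b" for a' b'
    using that wagner_mult[of a a' X b b'] by (simp add: fim_class_def fim_class_eqI[unfolded fim_class_def])
  then have "(\<Union>a' \<in> fim_class X a. \<Union>b' \<in> fim_class X b. fim_class X (a' @ b'))
      = (\<Union>a' \<in> fim_class X a. \<Union>b' \<in> fim_class X b. fim_class X (a @ b))"
    by simp
  moreover have "fim_class X a \<noteq> {}" "fim_class X b \<noteq> {}"
    using assms equiv_class_self[OF equiv_wagner] by (auto simp: fim_class_def)
  ultimately show ?thesis
    by (simp add: FIM_def quotient_monoid_def fim_class_def[symmetric])
qed

lemma monoid_FIM: "monoid (FIM X)"
  by unfold_locales (auto simp: fim_carrier fim_one fim_mult)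

lemma inverse_of_fim_class:
  assumes "w \<in> carrier (words X)"
  shows "inverse_of (FIM X) (fim_class X w) (fim_class X (word_inv w))"
proof -
  have "(v @ word_inv v @ v, v) \<in> wagner X" if "v \<in> carrier (words X)" for v
    using that wagner_base[of X] by (auto simp: wagner_pairs_def)
  from fim_class_eqI[OF this[of w]] fim_class_eqI[OF this[of "word_inv w"]]
  show ?thesis
    using assms by (simp add: inverse_of_def fim_carrier fim_mult)
qed

lemma idempotent_eq_mult_inverse:
  assumes "monoid S" "e \<in> idempotents S" "inverse_of S e f"
    and comm: "(e \<otimes>\<^bsub>S\<^esub> f) \<otimes>\<^bsub>S\<^esub> (f \<otimes>\<^bsub>S\<^esub> e) = (f \<otimes>\<^bsub>S\<^esub> e) \<otimes>\<^bsub>S\<^esub> (e \<otimes>\<^bsub>S\<^esub> f)"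
  shows "e = e \<otimes>\<^bsub>S\<^esub> f"
proof -
  interpret monoid S by fact
  let ?m = "mult S"
  have c: "e \<in> carrier S" "f \<in> carrier S" and ee: "?m e e = e"
    and efe: "?m (?m e f) e = e" and fef: "?m (?m f e) f = f"
    using assms by (auto simp: idempotents_def inverse_of_def)
  have "?m (?m f e) (?m e f) = ?m (?m f (?m e e)) f"
    using c by (simp add: m_assoc)
  then have f1: "?m (?m f e) (?m e f) = f" using ee fef by simp
  have ep: "?m e (?m e f) = ?m e f" using c ee by (simp flip: m_assoc)
  have "f = ?m (?m e f) (?m f e)" using f1 comm by simp
  then have "?m e f = ?m e (?m (?m e f) (?m f e))" by simp
  also have "\<dots> = ?m (?m e (?m e f)) (?m f e)" using c by (simp add: m_assoc)
  also have "\<dots> = f" using ep f1 comm by simp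
  finally have ef: "?m e f = f" .
  have qe: "?m (?m f e) e = ?m f e" using c ee by (simp add: m_assoc)
  have "f = ?m (?m e f) (?m f e)" using f1 comm by simp
  then have "?m f e = ?m (?m (?m e f) (?m f e)) e" by simp
  also have "\<dots> = ?m (?m e f) (?m (?m f e) e)" using c by (simp add: m_assoc)
  also have "\<dots> = f" using qe f1 comm by simp
  finally show ?thesis using ef efe by simp
qed

lemma fim_idempotents_commute:
  assumes "e \<in> idempotents (FIM X)" "f \<in> idempotents (FIM X)"
  shows "e \<otimes>\<^bsub>FIM X\<^esub> f = f \<otimes>\<^bsub>FIM X\<^esub> e"
proof -
  let ?c = "fim_class X"
  let ?m = "mult (FIM X)"
  have comm: "?m (?c (u @ word_inv u)) (?c (v @ word_inv v))
      = ?m (?c (v @ word_inv v)) (?c (u @ word_inv u))"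
    if "u \<in> carrier (words X)" "v \<in> carrier (words X)" for u v
  proof -
    have "(u @ word_inv u @ v @ word_inv v, v @ word_inv v @ u @ word_inv u) \<in> wagner X"
      using that wagner_base[of X] by (auto simp: wagner_pairs_def)
    from fim_class_eqI[OF this] show ?thesis using that by (simp add: fim_mult)
  qed
  have idem: "\<exists>u \<in> carrier (words X). e = ?c (u @ word_inv u)"
    if e: "e \<in> idempotents (FIM X)" for e
  proof -
    obtain w where w: "w \<in> carrier (words X)" "e = ?c w"
      using e by (auto simp: idempotents_def fim_carrier)
    then have w': "word_inv w \<in> carrier (words X)" by simp
    have "?c w = ?m (?c w) (?c (word_inv w))"
      using e w w' comm[OF w(1) w'] inverse_of_fim_class[OF w(1)]
      by (intro idempotent_eq_mult_inverse[OF monoid_FIM]) (simp_all add: fim_mult)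
    then show ?thesis using w w' by (auto simp: fim_mult)
  qed
  from idem[OF assms(1)] idem[OF assms(2)] comm show ?thesis by auto
qed

lemma inverse_unique_if_idempotents_commute:
  assumes "monoid S" "s \<in> carrier S" "inverse_of S s t" "inverse_of S s t'"
    and comm: "\<And>e f. e \<in> idempotents S \<Longrightarrow> f \<in> idempotents S \<Longrightarrow> e \<otimes>\<^bsub>S\<^esub> f = f \<otimes>\<^bsub>S\<^esub> e"
  shows "t = t'"
proof -
  interpret monoid S by fact
  let ?m = "mult S"
  have c: "s \<in> carrier S" "t \<in> carrier S" "t' \<in> carrier S"
    and t: "?m (?m s t) s = s" "?m (?m t s) t = t"
    and t': "?m (?m s t') s = s" "?m (?m t' s) t' = t'"
    using assms by (auto simp: inverse_of_def)
  have "?m (?m s t) (?m s t) = ?m (?m (?m s t) s) t" "?m (?m s t') (?m s t') = ?m (?m (?m s t') s) t'"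
    "?m (?m t s) (?m t s) = ?m t (?m (?m s t) s)" "?m (?m t' s) (?m t' s) = ?m t' (?m (?m s t') s)"
    using c by (simp_all add: m_assoc)
  then have idem: "?m s t \<in> idempotents S" "?m s t' \<in> idempotents S"
    "?m t s \<in> idempotents S" "?m t' s \<in> idempotents S"
    using c t t' by (simp_all add: idempotents_def)
  have "t = ?m t (?m (?m (?m s t') s) t)" using c t t' by (simp add: m_assoc)
  also have "\<dots> = ?m t (?m (?m s t') (?m s t))" using c by (simp add: m_assoc)
  also have "\<dots> = ?m t (?m (?m s t) (?m s t'))" using comm idem by simp
  also have "\<dots> = ?m (?m (?m t s) t) (?m s t')" using c by (simp add: m_assoc)
  also have "\<dots> = ?m (?m t s) t'" using c t by (simp add: m_assoc)
  finally have 1: "t = ?m (?m t s) t'" .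
  have "t' = ?m (?m t' (?m (?m s t) s)) t'" using t t' by simp
  also have "\<dots> = ?m (?m (?m t' s) (?m t s)) t'" using c by (simp add: m_assoc)
  also have "\<dots> = ?m (?m (?m t s) (?m t' s)) t'" using comm idem by simp
  also have "\<dots> = ?m (?m t s) (?m (?m t' s) t')" using c by (simp add: m_assoc)
  finally show ?thesis using 1 t' by simp
qed

theorem inverse_monoid_FIM: "inverse_monoid (FIM X)"
proof -
  have "\<exists>!t. inverse_of (FIM X) s t" if s: "s \<in> carrier (FIM X)" for s
  proof -
    from s obtain w where "w \<in> carrier (words X)" "s = fim_class X w"
      by (auto simp: fim_carrier)
    with inverse_of_fim_class have "inverse_of (FIM X) s (fim_class X (word_inv w))"
      by blast
    then show ?thesis
      using inverse_unique_if_idempotents_commute[OF monoid_FIM s _ _ fim_idempotents_commute]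
      by blast
  qed
  then show ?thesis by (simp add: inverse_monoid_def monoid_FIM)
qed

corollary sinv_fim_class:
  assumes "w \<in> carrier (words X)"
  shows "sinv (FIM X) (fim_class X w) = fim_class X (word_inv w)"
proof -
  have "fim_class X w \<in> carrier (FIM X)" using assms by (simp add: fim_carrier)
  then show ?thesis
    using inverse_monoid_FIM[of X] inverse_of_fim_class[OF assms]
    by (simp add: sinv_def inverse_monoid_def the1_equality)
qed


section \<open>Inverse monoid presentations\<close>

definition pres_congruence ::
    "'a set \<Rightarrow> ('a word set \<times> 'a word set) set \<Rightarrow> ('a word set \<times> 'a word set) set" where
  "pres_congruence X R = congruence_generated (FIM X) R"

definition pres_K :: "'a set \<Rightarrow> ('a word set \<times> 'a word set) set \<Rightarrow> 'a word set set" where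
  "pres_K X R = congruence_kernel (FIM X) (pres_congruence X R)"

definition pres_Q :: "'a set \<Rightarrow> ('a word set \<times> 'a word set) set \<Rightarrow> 'a word set set" where
  "pres_Q X R =
     (\<Union>(l, r) \<in> R. {sinv (FIM X) l \<otimes>\<^bsub>FIM X\<^esub> r, l \<otimes>\<^bsub>FIM X\<^esub> sinv (FIM X) r})"

definition pres_N :: "'a set \<Rightarrow> ('a word set \<times> 'a word set) set \<Rightarrow> 'a word set set" where
  "pres_N X R = normal_closure (FIM X) (pres_Q X R)"

end

(* Closing a normal inverse subsemigroup N upwards keeps it normal, and for an upward closed
   normal M the relation "a b^{-1} lies in M" is a congruence whose kernel is contained in M.
   Applied to the upward closure of N(P), it relates the two sides of every relator, so it contains
   the congruence generated by R. The first inclusion holds because the kernel of any congruence is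
   itself a normal inverse subsemigroup. *)

theory Submission
  imports Defs
begin

section \<open>Inverses and idempotents in an inverse monoid\<close>

locale inverse_monoid_on = monoid S for S (structure) +
  assumes inverse_monoid: "inverse_monoid S"
begin

abbreviation sinv_postfix :: "'a \<Rightarrow> 'a" ("_\<acute>" [1000] 1000) where
  "x\<acute> \<equiv> sinv S x"

lemma inverse_of_sinv: "x \<in> carrier S \<Longrightarrow> inverse_of S x (x\<acute>)"
  using inverse_monoid unfolding inverse_monoid_def sinv_def by (blast intro: theI')

text \<open>Uniqueness of inverses in usable form: identities for inverses are obtained below by
  checking that the candidate is an inverse.\<close>

lemma sinv_eqI: "x \<in> carrier S \<Longrightarrow> inverse_of S x y \<Longrightarrow> x\<acute> = y"
  using inverse_monoid inverse_of_sinv unfolding inverse_monoid_def by blast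

lemma sinv_closed [simp]: "x \<in> carrier S \<Longrightarrow> x\<acute> \<in> carrier S"
  using inverse_of_sinv by (simp add: inverse_of_def)

lemma mult_sinv_mult [simp]:
  assumes "x \<in> carrier S"
  shows "x \<otimes> (x\<acute> \<otimes> x) = x" "x\<acute> \<otimes> (x \<otimes> x\<acute>) = x\<acute>"
  using inverse_of_sinv[OF assms] assms by (simp_all add: inverse_of_def m_assoc)

text \<open>The cancellation laws with a trailing factor, needed because \<open>m_assoc\<close>
  brackets products to the right and so buries x x^{-1} x in front of further factors.\<close>

lemma mult_sinv_mult_left [simp]:
  assumes "x \<in> carrier S" "y \<in> carrier S"
  shows "x \<otimes> (x\<acute> \<otimes> (x \<otimes> y)) = x \<otimes> y" "x\<acute> \<otimes> (x \<otimes> (x\<acute> \<otimes> y)) = x\<acute> \<otimes> y"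
  using inverse_of_sinv[OF assms(1)] assms by (simp_all add: inverse_of_def flip: m_assoc)

lemma sinv_sinv [simp]: "x \<in> carrier S \<Longrightarrow> x\<acute>\<acute> = x"
  by (rule sinv_eqI) (simp_all add: inverse_of_def m_assoc)

lemma idempotent_closed: "e \<in> idempotents S \<Longrightarrow> e \<in> carrier S"
  by (simp add: idempotents_def)

lemma idempotent_mult_self: "e \<in> idempotents S \<Longrightarrow> e \<otimes> e = e"
  by (simp add: idempotents_def)

lemma idempotent_mult_self_left:
  "e \<in> idempotents S \<Longrightarrow> x \<in> carrier S \<Longrightarrow> e \<otimes> (e \<otimes> x) = e \<otimes> x"
  by (simp add: idempotents_def flip: m_assoc)

lemma sinv_idempotent: "e \<in> idempotents S \<Longrightarrow> e\<acute> = e"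
  by (rule sinv_eqI) (simp_all add: idempotents_def inverse_of_def)

lemma idempotent_mult_sinv:
  assumes "x \<in> carrier S"
  shows "x \<otimes> x\<acute> \<in> idempotents S" "x\<acute> \<otimes> x \<in> idempotents S"
  using assms by (simp_all add: idempotents_def m_assoc)

text \<open>If x is the inverse of e f, then f x e is also an inverse of e f, so x = f x e by
  uniqueness. This form makes x idempotent, hence its own inverse; but the inverse of x is e
  f.\<close>

lemma idempotent_mult:
  assumes "e \<in> idempotents S" "f \<in> idempotents S"
  shows "e \<otimes> f \<in> idempotents S"
proof -
  have c: "e \<in> carrier S" "f \<in> carrier S" using assms by (auto simp: idempotents_def)
  note id = assms[THEN idempotent_mult_self]
  note idl = assms[THEN idempotent_mult_self_left]
  define x where "x = (e \<otimes> f)\<acute>"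
  have x: "x \<in> carrier S" "e \<otimes> (f \<otimes> (x \<otimes> (e \<otimes> f))) = e \<otimes> f" "x \<otimes> (e \<otimes> (f \<otimes> x)) = x"
    using inverse_of_sinv[of "e \<otimes> f"] c by (simp_all add: inverse_of_def x_def m_assoc)
  have xl: "x \<otimes> (e \<otimes> (f \<otimes> (x \<otimes> y))) = x \<otimes> y" if "y \<in> carrier S" for y
    using arg_cong[OF x(3), of "\<lambda>z. z \<otimes> y"] that x(1) c by (simp add: m_assoc)
  have "inverse_of S (e \<otimes> f) (f \<otimes> (x \<otimes> e))"
    using c x xl id idl by (simp add: inverse_of_def m_assoc)
  then have "(e \<otimes> f)\<acute> = f \<otimes> (x \<otimes> e)"
    using c by (intro sinv_eqI) simp_all
  with x_def have fxe: "x = f \<otimes> (x \<otimes> e)" by (rule trans)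
  have "(f \<otimes> (x \<otimes> e)) \<otimes> (f \<otimes> (x \<otimes> e)) = f \<otimes> (x \<otimes> e)"
    using c x xl by (simp add: m_assoc)
  then have "x \<in> idempotents S"
    using x(1) by (simp add: idempotents_def flip: fxe)
  moreover have "e \<otimes> f = x\<acute>" using c by (simp add: x_def)
  ultimately show ?thesis by (simp add: sinv_idempotent)
qed

text \<open>Since e f and f e are idempotent, f e is an inverse of e f. As an idempotent, e f is
  also its own inverse, and inverses are unique.\<close>

lemma idempotents_commute:
  assumes "e \<in> idempotents S" "f \<in> idempotents S"
  shows "e \<otimes> f = f \<otimes> e"
proof -
  have c: "e \<in> carrier S" "f \<in> carrier S" using assms by (auto simp: idempotents_def)
  have ef: "e \<otimes> f \<in> idempotents S" "f \<otimes> e \<in> idempotents S"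
    using assms by (simp_all add: idempotent_mult)
  have "inverse_of S (e \<otimes> f) (f \<otimes> e)"
    using c ef[THEN idempotent_mult_self] assms[THEN idempotent_mult_self_left]
    by (simp add: inverse_of_def m_assoc)
  then have "(e \<otimes> f)\<acute> = f \<otimes> e" using c by (simp add: sinv_eqI)
  then show ?thesis using ef by (simp add: sinv_idempotent)
qed

lemma idempotents_left_commute:
  assumes "e \<in> idempotents S" "f \<in> idempotents S" "x \<in> carrier S"
  shows "e \<otimes> (f \<otimes> x) = f \<otimes> (e \<otimes> x)"
  using assms idempotents_commute[of e f] by (simp add: idempotent_closed flip: m_assoc)

lemma sinv_mult:
  assumes "x \<in> carrier S" "y \<in> carrier S"
  shows "(x \<otimes> y)\<acute> = y\<acute> \<otimes> x\<acute>"
proof (rule sinv_eqI)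
  \<comment> \<open>The idempotents x^{-1} x and y y^{-1} commute. This is used once in each
    direction, to bring x next to x^{-1} x, or y^{-1} next to y y^{-1}.\<close>
  have 1: "x\<acute> \<otimes> (x \<otimes> (y \<otimes> (y\<acute> \<otimes> z))) = y \<otimes> (y\<acute> \<otimes> (x\<acute> \<otimes> (x \<otimes> z)))"
    if "z \<in> carrier S" for z
    using idempotents_left_commute[of "x\<acute> \<otimes> x" "y \<otimes> y\<acute>" z] that assms
    by (simp add: idempotent_mult_sinv m_assoc)
  have "x \<otimes> (y \<otimes> (y\<acute> \<otimes> (x\<acute> \<otimes> (x \<otimes> y)))) = x \<otimes> y"
    using assms by (simp flip: 1)
  moreover have "y\<acute> \<otimes> (x\<acute> \<otimes> (x \<otimes> (y \<otimes> (y\<acute> \<otimes> x\<acute>)))) = y\<acute> \<otimes> x\<acute>"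
    using assms by (simp add: 1)
  ultimately show "inverse_of S (x \<otimes> y) (y\<acute> \<otimes> x\<acute>)"
    using assms by (simp add: inverse_of_def m_assoc)
qed (use assms in simp)

lemma idempotent_conj:
  assumes "x \<in> carrier S" "e \<in> idempotents S"
  shows "x\<acute> \<otimes> e \<otimes> x \<in> idempotents S"
proof -
  have c: "e \<in> carrier S" using assms(2) by (rule idempotent_closed)
  \<comment> \<open>Inside the square of x^{-1} e x the idempotent x x^{-1} is moved to the left of
    e, where x^{-1} absorbs it and the two copies of e meet.\<close>
  have "x\<acute> \<otimes> (e \<otimes> (x \<otimes> x\<acute> \<otimes> (e \<otimes> x))) = x\<acute> \<otimes> (x \<otimes> x\<acute> \<otimes> (e \<otimes> (e \<otimes> x)))"
    using assms c by (subst idempotents_left_commute) (simp_all add: idempotent_mult_sinv)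
  then show ?thesis
    using assms c by (simp add: idempotents_def[of S] m_assoc idempotent_mult_self_left)
qed

text \<open>Writing x = x x^{-1} x and commuting e with x^{-1} x moves the idempotent to the left of
  x, at the price of conjugation. Hence the natural order, defined with idempotents on the left, can
  equally be tested on the right.\<close>

lemma mult_idempotent:
  assumes "x \<in> carrier S" "e \<in> idempotents S"
  shows "x \<otimes> e = x \<otimes> e \<otimes> x\<acute> \<otimes> x"
proof -
  have c: "e \<in> carrier S" using assms(2) by (rule idempotent_closed)
  have "x \<otimes> e = x \<otimes> (x\<acute> \<otimes> x \<otimes> e)" using assms c by (simp add: m_assoc)
  also have "\<dots> = x \<otimes> (e \<otimes> (x\<acute> \<otimes> x))"
    using assms by (subst idempotents_commute) (simp_all add: idempotent_mult_sinv)
  finally show ?thesis using assms c by (simp add: m_assoc)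
qed

section \<open>Compatibility of the natural partial order with the operations\<close>

lemma nat_le_closed:
  assumes "nat_le S x y"
  shows "x \<in> carrier S" "y \<in> carrier S"
  using assms by (simp_all add: nat_le_def)

lemma nat_leI:
  "e \<in> idempotents S \<Longrightarrow> x \<in> carrier S \<Longrightarrow> nat_le S (e \<otimes> x) x"
  by (auto simp: nat_le_def idempotent_closed)

lemma nat_leI_right:
  assumes "e \<in> idempotents S" "x \<in> carrier S"
  shows "nat_le S (x \<otimes> e) x"
proof -
  have "x \<otimes> e \<otimes> x\<acute> \<in> idempotents S" using idempotent_conj[of "x\<acute>" e] assms by simp
  from nat_leI[OF this assms(2)] show ?thesis
    using mult_idempotent[of x e] assms by simp
qed

lemma nat_le_refl: "x \<in> carrier S \<Longrightarrow> nat_le S x x"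
  using nat_leI[of \<one> x] by (simp add: idempotents_def)

lemma nat_le_trans:
  assumes "nat_le S x y" "nat_le S y z"
  shows "nat_le S x z"
proof -
  obtain e f where "e \<in> idempotents S" "f \<in> idempotents S" "x = e \<otimes> (f \<otimes> z)" "z \<in> carrier S"
    using assms by (auto simp: nat_le_def)
  then show ?thesis
    using nat_leI[of "e \<otimes> f" z] by (simp add: idempotent_mult idempotent_closed m_assoc)
qed

lemma nat_le_mult_right:
  assumes "nat_le S x y" "z \<in> carrier S"
  shows "nat_le S (x \<otimes> z) (y \<otimes> z)"
  using assms nat_leI[of _ "y \<otimes> z"] by (auto simp: nat_le_def idempotent_closed m_assoc)

text \<open>The idempotent e ends up between z and y. The product z e lies below z by
  \<open>nat_leI_right\<close>, and multiplication by y on the right preserves this.\<close>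

lemma nat_le_mult_left:
  assumes "nat_le S x y" "z \<in> carrier S"
  shows "nat_le S (z \<otimes> x) (z \<otimes> y)"
proof -
  obtain e where e: "e \<in> idempotents S" "x = e \<otimes> y" and y: "y \<in> carrier S"
    using assms by (auto simp: nat_le_def)
  then have "z \<otimes> x = z \<otimes> e \<otimes> y" using assms(2) by (simp add: idempotent_closed m_assoc)
  then show ?thesis
    using nat_le_mult_right[OF nat_leI_right[OF e(1) assms(2)] y] by simp
qed

lemma nat_le_mult:
  assumes "nat_le S x y" "nat_le S x' y'"
  shows "nat_le S (x \<otimes> x') (y \<otimes> y')"
proof (rule nat_le_trans)
  show "nat_le S (x \<otimes> x') (y \<otimes> x')" "nat_le S (y \<otimes> x') (y \<otimes> y')"
    using assms by (simp_all add: nat_le_closed nat_le_mult_left nat_le_mult_right)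
qed

text \<open>Inversion turns e y into y^{-1} e, so the right-handed form of the order is what
  applies.\<close>

lemma nat_le_sinv:
  assumes "nat_le S x y"
  shows "nat_le S (x\<acute>) (y\<acute>)"
proof -
  obtain e where "e \<in> idempotents S" "x = e \<otimes> y" "y \<in> carrier S"
    using assms by (auto simp: nat_le_def)
  then show ?thesis
    using nat_leI_right[of e "y\<acute>"] by (simp add: sinv_mult idempotent_closed sinv_idempotent)
qed

section \<open>Normal inverse subsemigroups and their upward closures\<close>

lemma normal_carrier: "normal_inverse_subsemigroup S (carrier S)"
  by (auto simp: normal_inverse_subsemigroup_def inverse_subsemigroup_def idempotent_closed)

text \<open>The hypothesis puts \<open>carrier S\<close> into the family, which keeps the
  intersection inside the carrier; the remaining conditions pass to intersections.\<close>

lemma normal_normal_closure: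
  assumes "A \<subseteq> carrier S"
  shows "normal_inverse_subsemigroup S (normal_closure S A)"
proof -
  have "normal_closure S A \<subseteq> carrier S"
    using assms normal_carrier by (auto simp: normal_closure_def)
  then show ?thesis
    unfolding normal_inverse_subsemigroup_def inverse_subsemigroup_def normal_closure_def by blast
qed

lemma subset_up_closure: "A \<subseteq> carrier S \<Longrightarrow> A \<subseteq> up_closure S A"
  using nat_le_refl by (auto simp: up_closure_def)

lemma up_closure_upward_closed: "x \<in> up_closure S A \<Longrightarrow> nat_le S x y \<Longrightarrow> y \<in> up_closure S A"
  unfolding up_closure_def using nat_le_trans nat_le_closed by blast

text \<open>Products, inversion and conjugation are monotone for the natural order, so applying them
  to elements of \<open>N\<close> lying below the given ones yields the required lower bounds in
  \<open>N\<close>.\<close>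

lemma normal_up_closure:
  assumes "normal_inverse_subsemigroup S N"
  shows "normal_inverse_subsemigroup S (up_closure S N)"
proof -
  have N: "N \<subseteq> carrier S" "idempotents S \<subseteq> N"
    "\<And>m n. m \<in> N \<Longrightarrow> n \<in> N \<Longrightarrow> m \<otimes> n \<in> N" "\<And>n. n \<in> N \<Longrightarrow> n\<acute> \<in> N"
    "\<And>s n. s \<in> carrier S \<Longrightarrow> n \<in> N \<Longrightarrow> s\<acute> \<otimes> n \<otimes> s \<in> N"
    using assms by (auto simp: normal_inverse_subsemigroup_def inverse_subsemigroup_def)
  have "x \<otimes> y \<in> up_closure S N" if "x \<in> up_closure S N" "y \<in> up_closure S N" for x y
    using that N(3) nat_le_mult unfolding up_closure_def by fastforce
  moreover have "x\<acute> \<in> up_closure S N" if "x \<in> up_closure S N" for x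
    using that N(4) nat_le_sinv unfolding up_closure_def by fastforce
  moreover have "s\<acute> \<otimes> x \<otimes> s \<in> up_closure S N" if "x \<in> up_closure S N" "s \<in> carrier S" for x s
  proof -
    from that obtain n where "n \<in> N" "nat_le S n x" "x \<in> carrier S" by (auto simp: up_closure_def)
    then have "s\<acute> \<otimes> n \<otimes> s \<in> N" "nat_le S (s\<acute> \<otimes> n \<otimes> s) (s\<acute> \<otimes> x \<otimes> s)"
      using that(2) N(5) nat_le_mult_left nat_le_mult_right by simp_all
    then show ?thesis by (auto simp: up_closure_def nat_le_def)
  qed
  moreover have "idempotents S \<subseteq> up_closure S N" using N(2) subset_up_closure[OF N(1)] by blast
  moreover have "up_closure S N \<subseteq> carrier S" by (auto simp: up_closure_def)
  ultimately show ?thesis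
    by (auto simp: normal_inverse_subsemigroup_def inverse_subsemigroup_def)
qed

section \<open>The congruence defined by an upward closed normal inverse subsemigroup\<close>

text \<open>The analogue of congruence modulo a normal subgroup. In a group b^{-1} b cancels; here
  it is an idempotent that remains in the product, and upward closure of \<open>M\<close> removes it
  in the proof of transitivity.\<close>

lemma congruence_on_mult_sinv_mem:
  assumes "normal_inverse_subsemigroup S M"
    and up: "\<And>x y. x \<in> M \<Longrightarrow> nat_le S x y \<Longrightarrow> y \<in> M"
  shows "congruence_on S {(a, b). a \<in> carrier S \<and> b \<in> carrier S \<and> a \<otimes> b\<acute> \<in> M}"
proof -
  have M: "idempotents S \<subseteq> M"
    "\<And>m n. m \<in> M \<Longrightarrow> n \<in> M \<Longrightarrow> m \<otimes> n \<in> M" "\<And>n. n \<in> M \<Longrightarrow> n\<acute> \<in> M"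
    "\<And>s n. s \<in> carrier S \<Longrightarrow> n \<in> M \<Longrightarrow> s\<acute> \<otimes> n \<otimes> s \<in> M"
    using assms by (auto simp: normal_inverse_subsemigroup_def inverse_subsemigroup_def)
  have refl: "a \<otimes> a\<acute> \<in> M" if "a \<in> carrier S" for a
    using that M(1) idempotent_mult_sinv by blast
  have sym: "b \<otimes> a\<acute> \<in> M" if "a \<in> carrier S" "b \<in> carrier S" "a \<otimes> b\<acute> \<in> M" for a b
    using that M(3)[of "a \<otimes> b\<acute>"] by (simp add: sinv_mult)
  have trans: "a \<otimes> c\<acute> \<in> M"
    if c: "a \<in> carrier S" "b \<in> carrier S" "c \<in> carrier S" and "a \<otimes> b\<acute> \<in> M" "b \<otimes> c\<acute> \<in> M" for a b c
  proof -
    have "(a \<otimes> b\<acute>) \<otimes> (b \<otimes> c\<acute>) \<in> M" using that M(2) by blast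
    then have "a \<otimes> (b\<acute> \<otimes> b) \<otimes> c\<acute> \<in> M" using c by (simp add: m_assoc)
    moreover have "nat_le S (a \<otimes> (b\<acute> \<otimes> b) \<otimes> c\<acute>) (a \<otimes> c\<acute>)"
      using c by (intro nat_le_mult_right nat_leI_right idempotent_mult_sinv) simp_all
    ultimately show ?thesis by (rule up)
  qed
  \<comment> \<open>The product in question is c (a b^{-1}) c^{-1}, a conjugate by the inverse of
    c.\<close>
  have left: "(c \<otimes> a) \<otimes> (c \<otimes> b)\<acute> \<in> M"
    if "a \<in> carrier S" "b \<in> carrier S" "c \<in> carrier S" "a \<otimes> b\<acute> \<in> M" for a b c
    using that M(4)[of "c\<acute>" "a \<otimes> b\<acute>"] by (simp add: sinv_mult m_assoc)
  have right: "(a \<otimes> c) \<otimes> (b \<otimes> c)\<acute> \<in> M"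
    if c: "a \<in> carrier S" "b \<in> carrier S" "c \<in> carrier S" and "a \<otimes> b\<acute> \<in> M" for a b c
  proof -
    \<comment> \<open>The second factor is an idempotent, hence in \<open>M\<close>. Commuting
      b^{-1} b past c c^{-1} lets b^{-1} absorb it, and the product becomes (a c)(b c)^{-1}.\<close>
    have "(a \<otimes> b\<acute>) \<otimes> ((b \<otimes> c) \<otimes> (b \<otimes> c)\<acute>) \<in> M"
      using that M(2) refl by simp
    moreover have "b\<acute> \<otimes> (b \<otimes> (c \<otimes> (c\<acute> \<otimes> b\<acute>))) = c \<otimes> (c\<acute> \<otimes> b\<acute>)"
      using c idempotents_left_commute[of "b\<acute> \<otimes> b" "c \<otimes> c\<acute>" "b\<acute>"]
      by (simp add: idempotent_mult_sinv m_assoc)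
    ultimately show ?thesis using c by (simp add: sinv_mult m_assoc)
  qed
  let ?\<sigma> = "{(a, b). a \<in> carrier S \<and> b \<in> carrier S \<and> a \<otimes> b\<acute> \<in> M}"
  have "equiv (carrier S) ?\<sigma>"
  proof (rule equivI)
    show "refl_on (carrier S) ?\<sigma>" using refl by (simp add: refl_on_def)
    show "sym ?\<sigma>" using sym by (simp add: sym_def)
    show "trans ?\<sigma>" by (rule transI) (use trans in blast)
  qed auto
  then show ?thesis using left right by (simp add: congruence_on_def)
qed

text \<open>By minimality of the generated congruence, s and its idempotent e are related modulo the
  upward closure of \<open>N\<close>. Since e is its own inverse, s e lies in that closure, and s e
  lies below s.\<close>

lemma congruence_kernel_generated_subset_up_closure:
  assumes "normal_inverse_subsemigroup S N" "R \<subseteq> carrier S \<times> carrier S"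
    and R: "\<And>l r. (l, r) \<in> R \<Longrightarrow> l \<otimes> r\<acute> \<in> N"
  shows "congruence_kernel S (congruence_generated S R) \<subseteq> up_closure S N"
proof
  fix s assume "s \<in> congruence_kernel S (congruence_generated S R)"
  then obtain e where s: "s \<in> carrier S" and e: "e \<in> idempotents S"
    and se: "(s, e) \<in> congruence_generated S R"
    by (auto simp: congruence_kernel_def)
  define \<sigma> where
    "\<sigma> = {(a, b). a \<in> carrier S \<and> b \<in> carrier S \<and> a \<otimes> b\<acute> \<in> up_closure S N}"
  have "congruence_on S \<sigma>"
    unfolding \<sigma>_def using normal_up_closure[OF assms(1)] up_closure_upward_closed
    by (rule congruence_on_mult_sinv_mem)
  moreover have "N \<subseteq> carrier S"
    using assms(1) by (simp add: normal_inverse_subsemigroup_def inverse_subsemigroup_def)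
  then have "R \<subseteq> \<sigma>"
    using assms(2) R subset_up_closure[of N] by (auto simp: \<sigma>_def)
  ultimately have "(s, e) \<in> \<sigma>"
    using se by (auto simp: congruence_generated_def)
  then have "s \<otimes> e \<in> up_closure S N" using e by (simp add: \<sigma>_def sinv_idempotent)
  then show "s \<in> up_closure S N"
    using nat_leI_right[OF e s] by (rule up_closure_upward_closed)
qed

end

section \<open>Kernels of congruences\<close>

locale inverse_monoid_congruence = inverse_monoid_on +
  fixes \<rho>
  assumes congruence: "congruence_on S \<rho>"
begin

lemma
  shows congruence_refl: "x \<in> carrier S \<Longrightarrow> (x, x) \<in> \<rho>"
    and congruence_sym: "(x, y) \<in> \<rho> \<Longrightarrow> (y, x) \<in> \<rho>"
    and congruence_trans: "(x, y) \<in> \<rho> \<Longrightarrow> (y, z) \<in> \<rho> \<Longrightarrow> (x, z) \<in> \<rho>"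
    and congruence_closed: "(x, y) \<in> \<rho> \<Longrightarrow> x \<in> carrier S \<and> y \<in> carrier S"
    and congruence_left: "(x, y) \<in> \<rho> \<Longrightarrow> z \<in> carrier S \<Longrightarrow> (z \<otimes> x, z \<otimes> y) \<in> \<rho>"
    and congruence_right: "(x, y) \<in> \<rho> \<Longrightarrow> z \<in> carrier S \<Longrightarrow> (x \<otimes> z, y \<otimes> z) \<in> \<rho>"
proof -
  have eq: "equiv (carrier S) \<rho>" using congruence by (simp add: congruence_on_def)
  show "x \<in> carrier S \<Longrightarrow> (x, x) \<in> \<rho>" using eq by (auto elim: equivE dest: refl_onD)
  show "(x, y) \<in> \<rho> \<Longrightarrow> (y, x) \<in> \<rho>" using eq by (auto elim: equivE dest: symD)
  show "(x, y) \<in> \<rho> \<Longrightarrow> (y, z) \<in> \<rho> \<Longrightarrow> (x, z) \<in> \<rho>"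
    using eq by (meson equivE transD)
  show "(x, y) \<in> \<rho> \<Longrightarrow> x \<in> carrier S \<and> y \<in> carrier S"
    using equiv_type[OF eq] by auto
  show "(x, y) \<in> \<rho> \<Longrightarrow> z \<in> carrier S \<Longrightarrow> (z \<otimes> x, z \<otimes> y) \<in> \<rho>"
    and "(x, y) \<in> \<rho> \<Longrightarrow> z \<in> carrier S \<Longrightarrow> (x \<otimes> z, y \<otimes> z) \<in> \<rho>"
    using congruence by (simp_all add: congruence_on_def)
qed

lemma congruence_mult:
  assumes "(x, y) \<in> \<rho>" "(x', y') \<in> \<rho>"
  shows "(x \<otimes> x', y \<otimes> y') \<in> \<rho>"
proof (rule congruence_trans)
  show "(x \<otimes> x', y \<otimes> x') \<in> \<rho>" "(y \<otimes> x', y \<otimes> y') \<in> \<rho>"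
    using assms congruence_closed congruence_left congruence_right by simp_all
qed

(* Both inverses are congruent to a common product, x^{-1} x y^{-1}. *)
lemma congruence_sinv:
  assumes "(x, y) \<in> \<rho>"
  shows "(x\<acute>, y\<acute>) \<in> \<rho>"
proof -
  \<comment> \<open>Stated for an arbitrary related pair because the second conclusion is applied
    below to the pair (y, x).\<close>
  have half: "(y\<acute>, x\<acute> \<otimes> x \<otimes> y\<acute>) \<in> \<rho>" "(y\<acute>, y\<acute> \<otimes> (x \<otimes> x\<acute>)) \<in> \<rho>" if xy: "(x, y) \<in> \<rho>" for x y
  proof -
    have c: "x \<in> carrier S" "y \<in> carrier S" using congruence_closed xy by auto
    have "(y\<acute> \<otimes> y \<otimes> y\<acute>, y\<acute> \<otimes> x \<otimes> y\<acute>) \<in> \<rho>"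
      using c congruence_left[OF congruence_sym[OF xy], of "y\<acute>"] congruence_right by simp
    then have 1: "(y\<acute>, y\<acute> \<otimes> x \<otimes> y\<acute>) \<in> \<rho>" using c by (simp add: m_assoc)
    \<comment> \<open>Expand x as x x^{-1} x in y^{-1} x y^{-1} and replace only the first x by y;
      then y^{-1} y commutes past x^{-1} x and is absorbed by y^{-1}.\<close>
    have "(y\<acute> \<otimes> (x \<otimes> (x\<acute> \<otimes> x \<otimes> y\<acute>)), y\<acute> \<otimes> (y \<otimes> (x\<acute> \<otimes> x \<otimes> y\<acute>))) \<in> \<rho>"
      using c xy by (intro congruence_left congruence_right) simp_all
    moreover have "y\<acute> \<otimes> (y \<otimes> (x\<acute> \<otimes> x \<otimes> y\<acute>)) = x\<acute> \<otimes> x \<otimes> y\<acute>"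
      using c idempotents_left_commute[of "y\<acute> \<otimes> y" "x\<acute> \<otimes> x" "y\<acute>"]
      by (simp add: idempotent_mult_sinv m_assoc)
    ultimately show "(y\<acute>, x\<acute> \<otimes> x \<otimes> y\<acute>) \<in> \<rho>"
      using 1 c congruence_trans by (simp add: m_assoc)
    \<comment> \<open>The mirror image: this time only the last x of x x^{-1} x is replaced by
      y.\<close>
    have "(y\<acute> \<otimes> (x \<otimes> x\<acute>) \<otimes> x \<otimes> y\<acute>, y\<acute> \<otimes> (x \<otimes> x\<acute>) \<otimes> y \<otimes> y\<acute>) \<in> \<rho>"
      using c xy by (intro congruence_left congruence_right) simp_all
    moreover have "y\<acute> \<otimes> (x \<otimes> x\<acute>) \<otimes> y \<otimes> y\<acute> = y\<acute> \<otimes> (x \<otimes> x\<acute>)"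
      using c idempotents_commute[of "x \<otimes> x\<acute>" "y \<otimes> y\<acute>"]
      by (simp add: idempotent_mult_sinv m_assoc)
    ultimately show "(y\<acute>, y\<acute> \<otimes> (x \<otimes> x\<acute>)) \<in> \<rho>"
      using 1 c congruence_trans by (simp add: m_assoc)
  qed
  have c: "x \<in> carrier S" "y \<in> carrier S" using congruence_closed assms by auto
  have "(x\<acute>, x\<acute> \<otimes> (y \<otimes> y\<acute>)) \<in> \<rho>" using half(2) congruence_sym assms by blast
  moreover have "(x\<acute> \<otimes> (y \<otimes> y\<acute>), x\<acute> \<otimes> (x \<otimes> y\<acute>)) \<in> \<rho>"
    using c congruence_sym[OF assms] by (intro congruence_left congruence_right) simp_all
  moreover have "(x\<acute> \<otimes> (x \<otimes> y\<acute>), y\<acute>) \<in> \<rho>"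
    using c half(1)[OF assms] congruence_sym by (simp add: m_assoc)
  ultimately show ?thesis using congruence_trans by blast
qed

text \<open>Apply each operation to an element and to an idempotent related to it: the results stay
  related, and products, inverses and conjugates of idempotents are idempotent.\<close>

lemma normal_congruence_kernel: "normal_inverse_subsemigroup S (congruence_kernel S \<rho>)"
proof -
  let ?K = "congruence_kernel S \<rho>"
  have "x \<otimes> y \<in> ?K" if "x \<in> ?K" "y \<in> ?K" for x y
    using that congruence_mult idempotent_mult unfolding congruence_kernel_def by fastforce
  moreover have "x\<acute> \<in> ?K" if "x \<in> ?K" for x
    using that congruence_sinv sinv_idempotent unfolding congruence_kernel_def by fastforce
  moreover have "s\<acute> \<otimes> x \<otimes> s \<in> ?K" if "x \<in> ?K" "s \<in> carrier S" for x s
    using that congruence_left[of x _ "s\<acute>"] congruence_right idempotent_conj[of s]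
    unfolding congruence_kernel_def by fastforce
  moreover have "idempotents S \<subseteq> ?K"
    using congruence_refl idempotent_closed by (auto simp: congruence_kernel_def)
  moreover have "?K \<subseteq> carrier S" by (auto simp: congruence_kernel_def)
  ultimately show ?thesis
    by (auto simp: normal_inverse_subsemigroup_def inverse_subsemigroup_def)
qed

text \<open>Replacing y by x in the first product, or x by y in the second, gives an idempotent.
  Applied to relators, this places Q(R) in the kernel.\<close>

lemma mult_sinv_mem_kernel:
  assumes "(x, y) \<in> \<rho>"
  shows "x\<acute> \<otimes> y \<in> congruence_kernel S \<rho>" "x \<otimes> y\<acute> \<in> congruence_kernel S \<rho>"
proof -
  have c: "x \<in> carrier S" "y \<in> carrier S" using congruence_closed assms by auto
  have "(x\<acute> \<otimes> y, x\<acute> \<otimes> x) \<in> \<rho>" "(x \<otimes> y\<acute>, y \<otimes> y\<acute>) \<in> \<rho>"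
    using assms c congruence_sym congruence_left congruence_right by simp_all
  then show "x\<acute> \<otimes> y \<in> congruence_kernel S \<rho>" "x \<otimes> y\<acute> \<in> congruence_kernel S \<rho>"
    using c idempotent_mult_sinv unfolding congruence_kernel_def by auto
qed

end

section \<open>The two inclusions for a presentation\<close>

theorem proposition4p1:
  fixes X :: "'a set"
    and R :: "('a word set \<times> 'a word set) set"
  assumes "R \<subseteq> carrier (FIM X) \<times> carrier (FIM X)"
  shows "pres_N X R \<subseteq> pres_K X R \<and> pres_K X R \<subseteq> up_closure (FIM X) (pres_N X R)"
proof -
  interpret monoid "FIM X" by (rule monoid_FIM)
  interpret inverse_monoid_congruence "FIM X" "pres_congruence X R"
    by unfold_locales
      (simp_all add: inverse_monoid_FIM pres_congruence_def congruence_on_generated monoid_FIM assms)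
  have "R \<subseteq> pres_congruence X R"
    by (auto simp: pres_congruence_def congruence_generated_def)
  then have "pres_Q X R \<subseteq> pres_K X R"
    using mult_sinv_mem_kernel by (fastforce simp: pres_Q_def pres_K_def)
  \<comment> \<open>The kernel is a member of the family whose intersection is
    \<open>pres_N X R\<close>.\<close>
  then have "pres_N X R \<subseteq> pres_K X R"
    using normal_congruence_kernel by (auto simp: pres_N_def pres_K_def normal_closure_def)
  moreover have "pres_Q X R \<subseteq> carrier (FIM X)"
    using assms by (auto simp: pres_Q_def)
  then have "normal_inverse_subsemigroup (FIM X) (pres_N X R)"
    unfolding pres_N_def by (rule normal_normal_closure)
  then have "pres_K X R \<subseteq> up_closure (FIM X) (pres_N X R)"
    unfolding pres_K_def pres_congruence_def using assms
    by (rule congruence_kernel_generated_subset_up_closure)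
      (auto simp: pres_N_def normal_closure_def pres_Q_def)
  ultimately show ?thesis ..
qed

end
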